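(* Let $G$ be a finite simple graph with $n$ vertices, with at least one edge, and with exactly $c\geq 1$ connected components. Then the monomial cut ideal $I(G)$ has precisely $2^{n-c}$ minimal monomial generators.
   Context: Let $G$ be a finite simple graph with vertex set $V(G)=\{v_1,\dots,v_n\}$ (identified with $[n]=\{1,\dots,n\}$) and edge set $E(G)=\{e_1,\dots,e_m\}$, $m\ge 1$. Let $K$ be a field and $S=K[s_1,\dots,s_m,t_1,\dots,t_m]$ the standard graded polynomial ring with one pair of variables $s_i,t_i$ for each edge $e_i$. For $A\subseteq V(G)$ the cut monomial of $A$ with respect to $G$ is $u_A=\alpha_1\cdots\alpha_m\in S$, where $\alpha_i=s_i$ if exactly one of the two vertices of $e_i$ belongs to $A$, and $\alpha_i=t_i$ if both vertices of $e_i$ belong to $A$ or both belong to $V(G)\setminus A$. The monomial cut ideal of $G$ is $I(G)=\langle u_A : A\subseteq V(G)\rangle\subseteq S$. *)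

theory Defs
  imports "HOL-Library.Poly_Mapping" "HOL-Algebra.Ideal"
begin

section \<open>Finite simple graphs\<close>

text \<open>Edges are two-element sets of vertices.\<close>

definition finite_simple_graph :: "'a set \<Rightarrow> 'a set set \<Rightarrow> bool" where
  "finite_simple_graph V E \<longleftrightarrow> finite V \<and> (\<forall>e\<in>E. e \<subseteq> V \<and> card e = 2)"

definition connected_rel :: "'a set \<Rightarrow> 'a set set \<Rightarrow> ('a \<times> 'a) set" where
  "connected_rel V E = {(u, v). u \<in> V \<and> v \<in> V \<and> (\<lambda>x y. {x, y} \<in> E)\<^sup>*\<^sup>* u v}"

definition connected_components :: "'a set \<Rightarrow> 'a set set \<Rightarrow> 'a set set" where
  "connected_components V E = V // connected_rel V E"

section \<open>Polynomial rings in a given set of variables\<close>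

text \<open>
  A polynomial is a finitely supported map from exponent vectors to coefficients; its
  multiplication is the convolution product of \<^theory>\<open>HOL-Library.Poly_Mapping\<close>.
  The type contains a variable for every element of \<open>'v\<close>, so the polynomial ring in the
  variables \<open>X\<close> is carved out as a carrier set.
\<close>

type_synonym ('v, 'k) mpoly = "('v \<Rightarrow>\<^sub>0 nat) \<Rightarrow>\<^sub>0 'k"

definition mvar :: "'v \<Rightarrow> ('v, 'k::field) mpoly" where
  "mvar x = Poly_Mapping.single (Poly_Mapping.single x 1) 1"

definition mpoly_ring :: "'v set \<Rightarrow> ('v, 'k::field) mpoly ring" where
  "mpoly_ring X =
    \<lparr>carrier = {p. \<forall>m \<in> Poly_Mapping.keys p. Poly_Mapping.keys m \<subseteq> X},
     mult = (*), one = 1, zero = 0, add = (+)\<rparr>"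

definition monomials :: "'v set \<Rightarrow> ('v, 'k::field) mpoly set" where
  "monomials X = {Poly_Mapping.single m 1 | m. Poly_Mapping.keys m \<subseteq> X}"

text \<open>
  Minimality is with respect to inclusion. For a monomial ideal such a generating set exists
  and is unique; its elements are the minimal monomial generators of the ideal.
\<close>

definition minimal_monomial_generating_set ::
    "'v set \<Rightarrow> ('v, 'k::field) mpoly set \<Rightarrow> ('v, 'k) mpoly set \<Rightarrow> bool" where
  "minimal_monomial_generating_set X I B \<longleftrightarrow>
     B \<subseteq> monomials X \<and> genideal (mpoly_ring X) B = I \<and>
     (\<forall>B'. B' \<subset> B \<longrightarrow> genideal (mpoly_ring X) B' \<noteq> I)"

lemma keys_mult_subset:
  fixes p q :: "('v, 'k::field) mpoly"
  assumes p: "\<forall>m \<in> Poly_Mapping.keys p. Poly_Mapping.keys m \<subseteq> X"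
    and q: "\<forall>m \<in> Poly_Mapping.keys q. Poly_Mapping.keys m \<subseteq> X"
  shows "\<forall>m \<in> Poly_Mapping.keys (p * q). Poly_Mapping.keys m \<subseteq> X"
proof
  fix m assume "m \<in> Poly_Mapping.keys (p * q)"
  then obtain a b where m: "m = a + b"
    and a: "a \<in> Poly_Mapping.keys p" and b: "b \<in> Poly_Mapping.keys q"
    using keys_mult[of p q] by blast
  have "Poly_Mapping.keys a \<union> Poly_Mapping.keys b \<subseteq> X"
    using p q a b by simp
  then show "Poly_Mapping.keys m \<subseteq> X"
    unfolding m using Poly_Mapping.keys_add[of a b] by (rule order_trans[rotated])
qed

lemma keys_add_subset:
  fixes p q :: "('v, 'k::field) mpoly"
  assumes p: "\<forall>m \<in> Poly_Mapping.keys p. Poly_Mapping.keys m \<subseteq> X"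
    and q: "\<forall>m \<in> Poly_Mapping.keys q. Poly_Mapping.keys m \<subseteq> X"
  shows "\<forall>m \<in> Poly_Mapping.keys (p + q). Poly_Mapping.keys m \<subseteq> X"
proof
  fix m assume "m \<in> Poly_Mapping.keys (p + q)"
  then have "m \<in> Poly_Mapping.keys p \<union> Poly_Mapping.keys q"
    using Poly_Mapping.keys_add[of p q] by (rule rev_subsetD)
  then show "Poly_Mapping.keys m \<subseteq> X"
    using p q by (elim UnE) simp_all
qed

lemma cring_mpoly_ring: "cring (mpoly_ring X :: ('v, 'k::field) mpoly ring)"
proof (rule cringI)
  show "abelian_group (mpoly_ring X :: ('v, 'k) mpoly ring)"
  proof (rule abelian_groupI)
    fix p assume "p \<in> carrier (mpoly_ring X :: ('v, 'k) mpoly ring)"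
    then show "\<exists>q\<in>carrier (mpoly_ring X). q \<oplus>\<^bsub>mpoly_ring X\<^esub> p = \<zero>\<^bsub>mpoly_ring X\<^esub>"
      by (intro bexI[of _ "- p"]) (simp_all add: mpoly_ring_def)
  next
    fix p q assume "p \<in> carrier (mpoly_ring X :: ('v, 'k) mpoly ring)"
      "q \<in> carrier (mpoly_ring X :: ('v, 'k) mpoly ring)"
    then show "p \<oplus>\<^bsub>mpoly_ring X\<^esub> q \<in> carrier (mpoly_ring X)"
      unfolding mpoly_ring_def using keys_add_subset[of p X q] by simp
  qed (simp_all add: mpoly_ring_def add.assoc add.commute)
  show "Group.comm_monoid (mpoly_ring X :: ('v, 'k) mpoly ring)"
  proof (rule comm_monoidI)
    fix p q assume "p \<in> carrier (mpoly_ring X :: ('v, 'k) mpoly ring)"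
      "q \<in> carrier (mpoly_ring X :: ('v, 'k) mpoly ring)"
    then show "p \<otimes>\<^bsub>mpoly_ring X\<^esub> q \<in> carrier (mpoly_ring X)"
      unfolding mpoly_ring_def using keys_mult_subset[of p X q] by simp
  next
    fix p q :: "('v, 'k) mpoly"
    show "p \<otimes>\<^bsub>mpoly_ring X\<^esub> q = q \<otimes>\<^bsub>mpoly_ring X\<^esub> p"
      by (simp add: mpoly_ring_def mult.commute)
  qed (simp_all add: mpoly_ring_def mult.assoc)
qed (simp add: mpoly_ring_def distrib_right)

section \<open>Monomial cut ideals\<close>

text \<open>The variables are indexed by the edges themselves, not by an enumeration of them.\<close>

datatype 'e cut_var = S_var 'e | T_var 'e

definition cut_vars :: "'a set set \<Rightarrow> 'a set cut_var set" where
  "cut_vars E = S_var ` E \<union> T_var ` E"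

definition cut_monomial :: "'a set set \<Rightarrow> 'a set \<Rightarrow> ('a set cut_var, 'k::field) mpoly" where
  "cut_monomial E A = (\<Prod>e\<in>E. if card (e \<inter> A) = 1 then mvar (S_var e) else mvar (T_var e))"

definition monomial_cut_ideal ::
    "'a set \<Rightarrow> 'a set set \<Rightarrow> ('a set cut_var, 'k::field) mpoly set" where
  "monomial_cut_ideal V E = genideal (mpoly_ring (cut_vars E)) {cut_monomial E A | A. A \<subseteq> V}"

end

theory Submission imports Defs begin

text \<open>
  All cut monomials of a graph are squarefree of the same degree, one variable of each pair
  being chosen for every edge.  Hence none of them properly divides another, and an antichain
  of monomials is the unique minimal monomial generating set of the ideal it spans
  (\<open>minimal_generators_of_antichain\<close>).  The problem is thus to count the distinct cut monomials,
  that is, the distinct cuts.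

  Choose a representative \<open>r v\<close> of the component of every vertex \<open>v\<close>, and let \<open>R\<close> be the set of
  the \<open>c\<close> representatives.  A cut determines, for connected \<open>u\<close> and \<open>v\<close>, whether \<open>A\<close>
  separates \<open>u\<close> from \<open>v\<close> (\<open>same_cut_connected\<close>); if \<open>A\<close> avoids \<open>R\<close>, then separating \<open>v\<close> from
  \<open>r v\<close> means \<open>v \<in> A\<close>, so that \<open>A\<close> is recovered from its cut.  Conversely, complementing \<open>A\<close> on
  each component whose representative lies in \<open>A\<close> makes it avoid \<open>R\<close> without changing
  the cut.  The cuts are therefore in bijection with the subsets of \<open>V - R\<close>, and there are
  \<open>2 ^ (n - c)\<close> of these.
\<close>

section \<open>Ideals generated by an antichain of monomials\<close>

lemma mpoly_ring_minus:
  fixes p :: "('v, 'k::field) mpoly"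
  assumes "p \<in> carrier (mpoly_ring X)"
  shows "inv\<^bsub>add_monoid (mpoly_ring X)\<^esub> p = - p"
proof -
  interpret cring "mpoly_ring X :: ('v, 'k) mpoly ring" by (rule cring_mpoly_ring)
  have "\<ominus>\<^bsub>mpoly_ring X\<^esub> p = - p"
    by (rule minus_equality) (use assms in \<open>simp_all add: mpoly_ring_def\<close>)
  then show ?thesis by (simp add: a_inv_def)
qed

lemma ideal_of_multiples:
  "ideal {p :: ('v, 'k::field) mpoly. p \<in> carrier (mpoly_ring X) \<and>
      (\<forall>k\<in>Poly_Mapping.keys p. \<exists>m\<in>M. \<exists>d. k = m + d)} (mpoly_ring X)"
    (is "ideal ?J ?R")
proof -
  interpret cring "?R" by (rule cring_mpoly_ring)
  have absorb: "x * p \<in> ?J" if p: "p \<in> ?J" and x: "x \<in> carrier ?R" for p x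
  proof -
    have "x * p \<in> carrier ?R"
      using m_closed[of x p] p x by (simp add: mpoly_ring_def)
    moreover have "\<exists>m\<in>M. \<exists>d. k = m + d" if k: "k \<in> Poly_Mapping.keys (x * p)" for k
    proof -
      obtain a b where "k = a + b" "b \<in> Poly_Mapping.keys p"
        using k keys_mult[of x p] by blast
      moreover then obtain m d where "m \<in> M" "b = m + d" using p by blast
      ultimately have "k = m + (a + d)" by (simp add: ac_simps)
      with \<open>m \<in> M\<close> show ?thesis by blast
    qed
    ultimately show ?thesis by blast
  qed
  show ?thesis
  proof (rule idealI)
    show "subgroup ?J (add_monoid ?R)"
    proof (rule subgroup.intro)
      fix p q assume pq: "p \<in> ?J" "q \<in> ?J"
      then have "p + q \<in> carrier ?R"
        using a_closed[of p q] by (simp add: mpoly_ring_def)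
      moreover have "Poly_Mapping.keys (p + q) \<subseteq> Poly_Mapping.keys p \<union> Poly_Mapping.keys q"
        by (rule Poly_Mapping.keys_add)
      ultimately have "p + q \<in> ?J" using pq by blast
      then show "p \<otimes>\<^bsub>add_monoid ?R\<^esub> q \<in> ?J" by (simp add: mpoly_ring_def)
    next
      fix p assume "p \<in> ?J"
      then show "inv\<^bsub>add_monoid ?R\<^esub> p \<in> ?J"
        using mpoly_ring_minus[of p X] by (simp add: mpoly_ring_def)
    qed (auto simp: mpoly_ring_def)
  next
    fix p x assume "p \<in> ?J" "x \<in> carrier ?R"
    then show "x \<otimes>\<^bsub>?R\<^esub> p \<in> ?J" "p \<otimes>\<^bsub>?R\<^esub> x \<in> ?J"
      using absorb[of p x] by (simp_all add: mpoly_ring_def mult.commute)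
  qed (rule ring_axioms)
qed

text \<open>
  Membership of a monomial in an ideal generated by monomials is divisibility by one of the
  generators, since the polynomials all of whose terms have this property form an ideal.
\<close>

lemma monomial_in_genidealD:
  assumes B: "B \<subseteq> (monomials X :: ('v, 'k::field) mpoly set)"
    and k: "Poly_Mapping.single k 1 \<in> genideal (mpoly_ring X) B"
  obtains m d where "Poly_Mapping.single m 1 \<in> B" "k = m + d"
proof -
  let ?R = "mpoly_ring X :: ('v, 'k) mpoly ring"
  interpret cring ?R by (rule cring_mpoly_ring)
  define M where "M = {m. Poly_Mapping.single m 1 \<in> B}"
  have "B \<subseteq> {p \<in> carrier ?R. \<forall>k\<in>Poly_Mapping.keys p. \<exists>m\<in>M. \<exists>d. k = m + d}"
  proof
    fix b assume b: "b \<in> B"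
    then obtain m where m: "b = Poly_Mapping.single m 1" "Poly_Mapping.keys m \<subseteq> X"
      using B by (auto simp: monomials_def)
    then have "m \<in> M" using b by (simp add: M_def)
    then have "\<exists>m'\<in>M. \<exists>d. m = m' + d" by (metis add_0_right)
    then show "b \<in> {p \<in> carrier ?R. \<forall>k\<in>Poly_Mapping.keys p. \<exists>m\<in>M. \<exists>d. k = m + d}"
      using m by (auto simp: mpoly_ring_def)
  qed
  then have "genideal ?R B \<subseteq> {p \<in> carrier ?R. \<forall>k\<in>Poly_Mapping.keys p. \<exists>m\<in>M. \<exists>d. k = m + d}"
    using genideal_minimal[OF ideal_of_multiples] by blast
  then have "\<forall>k'\<in>Poly_Mapping.keys (Poly_Mapping.single k (1::'k)). \<exists>m\<in>M. \<exists>d. k' = m + d"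
    using k by blast
  then show thesis using that by (auto simp: M_def)
qed

lemma single_one_inject:
  assumes "Poly_Mapping.single m (1::'k::field) = Poly_Mapping.single m' 1"
  shows "m = m'"
  using arg_cong[OF assms, of Poly_Mapping.keys] by simp

text \<open>
  A monomial generating set \<open>B\<close> must contain every generator \<open>m\<close> of the antichain: \<open>m\<close> is
  divisible by some element of \<open>B\<close>, which is in turn divisible by some element of the
  antichain, and the latter can only be \<open>m\<close> itself.
\<close>

lemma antichain_subset_monomial_generators:
  fixes M :: "('v \<Rightarrow>\<^sub>0 nat) set" and B :: "('v, 'k::field) mpoly set"
  assumes M: "\<And>m. m \<in> M \<Longrightarrow> Poly_Mapping.keys m \<subseteq> X"
    and antichain: "\<And>m d. m \<in> M \<Longrightarrow> m + d \<in> M \<Longrightarrow> d = 0"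
    and B: "B \<subseteq> monomials X"
    and gen: "genideal (mpoly_ring X) B
        = genideal (mpoly_ring X) ((\<lambda>m. Poly_Mapping.single m 1) ` M)"
  shows "(\<lambda>m. Poly_Mapping.single m 1) ` M \<subseteq> B"
proof
  let ?R = "mpoly_ring X :: ('v, 'k) mpoly ring"
  let ?G = "(\<lambda>m. Poly_Mapping.single m 1) ` M :: ('v, 'k) mpoly set"
  interpret cring ?R by (rule cring_mpoly_ring)
  have G: "?G \<subseteq> monomials X" using M by (auto simp: monomials_def)
  have monomials_carrier: "monomials X \<subseteq> carrier ?R"
    by (auto simp: monomials_def mpoly_ring_def)
  fix g assume "g \<in> ?G"
  then obtain m where m: "m \<in> M" "g = Poly_Mapping.single m 1" by blast
  have "g \<in> genideal ?R B"
    using \<open>g \<in> ?G\<close> genideal_self[of ?G] G monomials_carrier unfolding gen by blast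
  then obtain b d where b: "Poly_Mapping.single b 1 \<in> B" "m = b + d"
    using monomial_in_genidealD[OF B] m by blast
  then have "Poly_Mapping.single b 1 \<in> genideal ?R ?G"
    using genideal_self[of B] B monomials_carrier unfolding gen by blast
  then obtain m' d' where "Poly_Mapping.single m' (1::'k) \<in> ?G" and b': "b = m' + d'"
    using monomial_in_genidealD[OF G] by blast
  then have m': "m' \<in> M" by (auto dest: single_one_inject)
  have eq: "m = m' + (d' + d)" using b b' by (simp add: add.assoc)
  with m m' have sum0: "d' + d = 0" using antichain[of m' "d' + d"] by simp
  have "d = 0"
  proof (rule poly_mapping_eqI)
    fix x
    have "Poly_Mapping.lookup (d' + d) x = 0" using sum0 by simp
    then show "Poly_Mapping.lookup d x = Poly_Mapping.lookup 0 x"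
      by (simp add: lookup_add)
  qed
  then show "g \<in> B" using b m by simp
qed

lemma minimal_generators_of_antichain:
  fixes M :: "('v \<Rightarrow>\<^sub>0 nat) set" and B :: "('v, 'k::field) mpoly set"
  assumes M: "\<And>m. m \<in> M \<Longrightarrow> Poly_Mapping.keys m \<subseteq> X"
    and antichain: "\<And>m d. m \<in> M \<Longrightarrow> m + d \<in> M \<Longrightarrow> d = 0"
  shows "minimal_monomial_generating_set X
           (genideal (mpoly_ring X) ((\<lambda>m. Poly_Mapping.single m 1) ` M)) B
         \<longleftrightarrow> B = (\<lambda>m. Poly_Mapping.single m 1) ` M"
proof -
  let ?G = "(\<lambda>m. Poly_Mapping.single m 1) ` M :: ('v, 'k) mpoly set"
  have G: "?G \<subseteq> monomials X" using M by (auto simp: monomials_def)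
  have least: "?G \<subseteq> B'"
    if "B' \<subseteq> monomials X" "genideal (mpoly_ring X) B' = genideal (mpoly_ring X) ?G"
    for B' :: "('v, 'k) mpoly set"
    by (rule antichain_subset_monomial_generators[OF _ _ that])
      (erule M, erule antichain, assumption)
  show ?thesis
    unfolding minimal_monomial_generating_set_def
  proof (intro iffI conjI allI impI)
    assume B: "B \<subseteq> monomials X \<and> genideal (mpoly_ring X) B = genideal (mpoly_ring X) ?G \<and>
      (\<forall>B'. B' \<subset> B \<longrightarrow> genideal (mpoly_ring X) B' \<noteq> genideal (mpoly_ring X) ?G)"
    then have "?G \<subseteq> B" by (intro least) blast+
    moreover have "\<not> ?G \<subset> B" using B by blast
    ultimately show "B = ?G" by blast
  next
    assume "B = ?G"
    then show "B \<subseteq> monomials X" "genideal (mpoly_ring X) B = genideal (mpoly_ring X) ?G"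
      using G by simp_all
    fix B' assume "B' \<subset> B"
    with \<open>B = ?G\<close> have "B' \<subset> ?G" by blast
    then show "genideal (mpoly_ring X) B' \<noteq> genideal (mpoly_ring X) ?G"
      using least[of B'] G by blast
  qed
qed

section \<open>Cut monomials\<close>

definition cut_exponent :: "'a set set \<Rightarrow> 'a set \<Rightarrow> 'a set cut_var \<Rightarrow>\<^sub>0 nat" where
  "cut_exponent E A =
    (\<Sum>e\<in>E. Poly_Mapping.single (if card (e \<inter> A) = 1 then S_var e else T_var e) 1)"

lemma cut_monomial_eq_single:
  "(cut_monomial E A :: ('a set cut_var, 'k::field) mpoly) =
     Poly_Mapping.single (cut_exponent E A) 1"
proof (induction E rule: infinite_finite_induct)
  case (insert e E)
  then show ?case
    by (simp add: cut_monomial_def cut_exponent_def mvar_def mult_single)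
qed (simp_all add: cut_monomial_def cut_exponent_def)

lemma lookup_cut_exponent:
  assumes "finite E"
  shows "Poly_Mapping.lookup (cut_exponent E A) (S_var e)
           = (if e \<in> E \<and> card (e \<inter> A) = 1 then 1 else 0)"
    and "Poly_Mapping.lookup (cut_exponent E A) (T_var e)
           = (if e \<in> E \<and> card (e \<inter> A) \<noteq> 1 then 1 else 0)"
proof -
  have "Poly_Mapping.lookup (cut_exponent E A) (S_var e)
      = (\<Sum>e'\<in>E. if e' = e then if card (e \<inter> A) = 1 then 1 else 0 else 0)"
    unfolding cut_exponent_def lookup_sum
    by (rule sum.cong) (auto simp: lookup_single when_def)
  then show "Poly_Mapping.lookup (cut_exponent E A) (S_var e)
           = (if e \<in> E \<and> card (e \<inter> A) = 1 then 1 else 0)"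
    using assms by simp
  have "Poly_Mapping.lookup (cut_exponent E A) (T_var e)
      = (\<Sum>e'\<in>E. if e' = e then if card (e \<inter> A) \<noteq> 1 then 1 else 0 else 0)"
    unfolding cut_exponent_def lookup_sum
    by (rule sum.cong) (auto simp: lookup_single when_def)
  then show "Poly_Mapping.lookup (cut_exponent E A) (T_var e)
           = (if e \<in> E \<and> card (e \<inter> A) \<noteq> 1 then 1 else 0)"
    using assms by simp
qed

lemma keys_cut_exponent:
  assumes "finite E"
  shows "Poly_Mapping.keys (cut_exponent E A) \<subseteq> cut_vars E"
proof
  fix x assume "x \<in> Poly_Mapping.keys (cut_exponent E A)"
  then show "x \<in> cut_vars E"
    by (cases x)
      (auto simp: in_keys_iff lookup_cut_exponent[OF assms] cut_vars_def split: if_splits)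
qed

lemma cut_exponent_eq_iff:
  assumes "finite E"
  shows "cut_exponent E A = cut_exponent E B
     \<longleftrightarrow> (\<forall>e\<in>E. card (e \<inter> A) = 1 \<longleftrightarrow> card (e \<inter> B) = 1)"
proof
  assume eq: "cut_exponent E A = cut_exponent E B"
  show "\<forall>e\<in>E. card (e \<inter> A) = 1 \<longleftrightarrow> card (e \<inter> B) = 1"
  proof
    fix e assume "e \<in> E"
    then show "card (e \<inter> A) = 1 \<longleftrightarrow> card (e \<inter> B) = 1"
      using arg_cong[OF eq, of "\<lambda>p. Poly_Mapping.lookup p (S_var e)"]
      by (cases "card (e \<inter> A) = 1"; cases "card (e \<inter> B) = 1")
        (simp_all add: lookup_cut_exponent[OF assms])
  qed
next
  assume "\<forall>e\<in>E. card (e \<inter> A) = 1 \<longleftrightarrow> card (e \<inter> B) = 1"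
  then show "cut_exponent E A = cut_exponent E B"
    unfolding cut_exponent_def by (intro sum.cong refl) simp
qed

text \<open>
  If \<open>u\<^sub>A\<close> divides \<open>u\<^sub>B\<close>, the variable that \<open>u\<^sub>A\<close> chooses for an edge must also be the one
  that \<open>u\<^sub>B\<close> chooses.
\<close>

lemma cut_exponent_antichain:
  assumes "finite E" and eq: "cut_exponent E B = cut_exponent E A + d"
  shows "d = 0"
proof -
  have lookup: "Poly_Mapping.lookup (cut_exponent E B) x
      = Poly_Mapping.lookup (cut_exponent E A) x + Poly_Mapping.lookup d x" for x
    by (simp add: eq lookup_add)
  have "card (e \<inter> A) = 1 \<longleftrightarrow> card (e \<inter> B) = 1" if "e \<in> E" for e
    using lookup[of "S_var e"] lookup[of "T_var e"] that
    by (cases "card (e \<inter> A) = 1"; cases "card (e \<inter> B) = 1")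
      (simp_all add: lookup_cut_exponent[OF assms(1)])
  then have "cut_exponent E B = cut_exponent E A"
    by (simp add: cut_exponent_eq_iff[OF assms(1)])
  then show ?thesis using eq by simp
qed

section \<open>Counting cuts\<close>

lemma card_doubleton_Int_eq_1_iff:
  assumes "x \<noteq> y"
  shows "card ({x, y} \<inter> A) = 1 \<longleftrightarrow> (x \<in> A) \<noteq> (y \<in> A)"
  using assms by (simp add: Int_insert_left)

lemma finite_simple_graph_edgeE:
  assumes "finite_simple_graph V E" "e \<in> E"
  obtains x y where "e = {x, y}" "x \<noteq> y" "x \<in> V" "y \<in> V"
  using assms by (fastforce simp: finite_simple_graph_def card_2_iff)

lemma finite_simple_graph_finite_edges:
  assumes "finite_simple_graph V E"
  shows "finite E"
proof (rule finite_subset)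
  show "E \<subseteq> Pow V" "finite (Pow V)" using assms by (auto simp: finite_simple_graph_def)
qed

text \<open>
  A path leaves or enters \<open>A\<close> exactly at its cut edges, so the parity of their number tells
  whether its endpoints are separated by \<open>A\<close>.
\<close>

lemma same_cut_connected:
  assumes graph: "finite_simple_graph V E"
    and cut: "\<forall>e\<in>E. card (e \<inter> A) = 1 \<longleftrightarrow> card (e \<inter> B) = 1"
    and conn: "(\<lambda>x y. {x, y} \<in> E)\<^sup>*\<^sup>* u v"
  shows "(u \<in> A) \<noteq> (v \<in> A) \<longleftrightarrow> (u \<in> B) \<noteq> (v \<in> B)"
  using conn
proof induction
  case (step y z)
  then have "y \<noteq> z" using graph by (auto simp: finite_simple_graph_def)
  then have "(y \<in> A) \<noteq> (z \<in> A) \<longleftrightarrow> (y \<in> B) \<noteq> (z \<in> B)"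
    using bspec[OF cut step.hyps(2)]
    unfolding card_doubleton_Int_eq_1_iff[OF \<open>y \<noteq> z\<close>] by blast
  with step.IH show ?case by blast
qed simp

lemma equiv_connected_rel: "equiv V (connected_rel V E)"
proof (rule equivI)
  have "symp (\<lambda>x y. {x, y} \<in> E)" by (auto simp: symp_def insert_commute)
  then have "symp (\<lambda>x y. {x, y} \<in> E)\<^sup>*\<^sup>*" by (rule symp_rtranclp)
  then show "sym (connected_rel V E)"
    by (auto simp: sym_def connected_rel_def dest: sympD)
  show "trans (connected_rel V E)"
    by (auto simp: trans_def connected_rel_def)
qed (auto simp: refl_on_def connected_rel_def)

text \<open>
  Representatives are packaged as a map on the elements rather than on the classes, so that
  an element can be compared directly with the representative of its class.
\<close>

lemma equiv_representatives:
  assumes equiv: "equiv V r"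
  obtains f where "\<And>v. v \<in> V \<Longrightarrow> (v, f v) \<in> r"
    and "\<And>u v. (u, v) \<in> r \<Longrightarrow> f u = f v"
    and "card (f ` V) = card (V // r)"
proof
  let ?f = "\<lambda>v. SOME u. u \<in> r `` {v}"
  show rel: "(v, ?f v) \<in> r" if "v \<in> V" for v
    using someI[of "\<lambda>u. u \<in> r `` {v}" v] equiv_class_self[OF equiv that] by simp
  show cong: "?f u = ?f v" if "(u, v) \<in> r" for u v
    using equiv_class_eq[OF equiv that] by simp
  have "inj_on (\<lambda>C. SOME u. u \<in> C) (V // r)"
  proof (rule inj_onI)
    fix C D assume CD: "C \<in> V // r" "D \<in> V // r" and eq: "(SOME u. u \<in> C) = (SOME u. u \<in> D)"
    have "(SOME u. u \<in> C) \<in> C" "(SOME u. u \<in> D) \<in> D"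
      using CD in_quotient_imp_non_empty[OF equiv] by (auto simp: some_in_eq)
    then show "C = D" using quotient_disj[OF equiv CD] eq by auto
  qed
  moreover have "?f ` V = (\<lambda>C. SOME u. u \<in> C) ` (V // r)"
    by (simp add: quotient_def image_UN UNION_singleton_eq_range image_image)
  ultimately show "card (?f ` V) = card (V // r)" by (simp add: card_image)
qed

lemma card_cut_exponents:
  assumes graph: "finite_simple_graph V E"
  shows "card (cut_exponent E ` Pow V) = 2 ^ (card V - card (connected_components V E))"
proof -
  have finite: "finite V" "finite E"
    using graph finite_simple_graph_finite_edges by (auto simp: finite_simple_graph_def)
  obtain r where r: "\<And>v. v \<in> V \<Longrightarrow> (v, r v) \<in> connected_rel V E"
    and r_cong: "\<And>u v. (u, v) \<in> connected_rel V E \<Longrightarrow> r u = r v"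
    and card_r: "card (r ` V) = card (connected_components V E)"
    unfolding connected_components_def
    using equiv_representatives[OF equiv_connected_rel] by metis
  have rV: "r ` V \<subseteq> V" using r by (auto simp: connected_rel_def)
  have "inj_on (cut_exponent E) (Pow (V - r ` V))"
  proof (rule inj_onI)
    fix A B assume AB: "A \<in> Pow (V - r ` V)" "B \<in> Pow (V - r ` V)"
      and eq: "cut_exponent E A = cut_exponent E B"
    have "v \<in> A \<longleftrightarrow> v \<in> B" if "v \<in> V" for v
    proof -
      have "(v \<in> A) \<noteq> (r v \<in> A) \<longleftrightarrow> (v \<in> B) \<noteq> (r v \<in> B)"
        using r[OF that] eq same_cut_connected[OF graph]
        by (simp add: cut_exponent_eq_iff[OF finite(2)] connected_rel_def)
      moreover have "r v \<notin> A" "r v \<notin> B" using AB that by auto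
      ultimately show ?thesis by simp
    qed
    then show "A = B" using AB by blast
  qed
  moreover have "cut_exponent E ` Pow V = cut_exponent E ` Pow (V - r ` V)"
  proof
    show "cut_exponent E ` Pow V \<subseteq> cut_exponent E ` Pow (V - r ` V)"
    proof (rule image_subsetI)
      fix A
      \<comment> \<open>\<open>A\<close>, complemented on the components whose representative it contains\<close>
      define A' where "A' = {v \<in> V. (v \<in> A) \<noteq> (r v \<in> A)}"
      have "r (r v) = r v" if "v \<in> V" for v using r_cong[OF r[OF that]] by simp
      then have "A' \<subseteq> V - r ` V" by (auto simp: A'_def)
      moreover have "card (e \<inter> A) = 1 \<longleftrightarrow> card (e \<inter> A') = 1" if e: "e \<in> E" for e
      proof -
        obtain x y where xy: "e = {x, y}" "x \<noteq> y" "x \<in> V" "y \<in> V"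
          using finite_simple_graph_edgeE[OF graph e] .
        then have "(x, y) \<in> connected_rel V E" using e by (auto simp: connected_rel_def)
        then have "r x = r y" by (rule r_cong)
        with xy have "(x \<in> A) \<noteq> (y \<in> A) \<longleftrightarrow> (x \<in> A') \<noteq> (y \<in> A')"
          by (auto simp: A'_def)
        then show ?thesis
          unfolding xy(1) card_doubleton_Int_eq_1_iff[OF xy(2)] .
      qed
      then have "cut_exponent E A = cut_exponent E A'"
        by (simp add: cut_exponent_eq_iff[OF finite(2)])
      ultimately show "cut_exponent E A \<in> cut_exponent E ` Pow (V - r ` V)" by blast
    qed
  qed auto
  ultimately have "card (cut_exponent E ` Pow V) = 2 ^ card (V - r ` V)"
    using finite by (simp add: card_image card_Pow)
  then show ?thesis
    using card_Diff_subset[OF finite_subset[OF rV finite(1)] rV] card_r by simp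
qed

section \<open>The number of minimal generators\<close>

theorem lemma1p1:
  fixes V :: "'a set" and E :: "'a set set" and n c :: nat
    and I :: "('a set cut_var, 'k::field) mpoly set"
  assumes "finite_simple_graph V E"
    and "card V = n"
    and "E \<noteq> {}"
    and "card (connected_components V E) = c"
    and "c \<ge> 1"
    and "I = monomial_cut_ideal V E"
  shows "(\<exists>!B. minimal_monomial_generating_set (cut_vars E) I B) \<and>
         (\<forall>B. minimal_monomial_generating_set (cut_vars E) I B \<longrightarrow> card B = 2 ^ (n - c))"
proof -
  let ?M = "cut_exponent E ` Pow V"
  let ?G = "(\<lambda>m. Poly_Mapping.single m 1) ` ?M :: ('a set cut_var, 'k) mpoly set"
  have finite: "finite E" by (rule finite_simple_graph_finite_edges[OF assms(1)])
  have "{cut_monomial E A | A. A \<subseteq> V} = ?G"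
    by (auto simp: cut_monomial_eq_single)
  then have I: "I = genideal (mpoly_ring (cut_vars E)) ?G"
    by (simp add: assms(6) monomial_cut_ideal_def)
  have minimal_iff: "minimal_monomial_generating_set (cut_vars E) I B \<longleftrightarrow> B = ?G" for B
    unfolding I
  proof (rule minimal_generators_of_antichain)
    show "Poly_Mapping.keys m \<subseteq> cut_vars E" if "m \<in> ?M" for m
      using that keys_cut_exponent[OF finite] by blast
    show "d = 0" if "m \<in> ?M" "m + d \<in> ?M" for m d
      using that cut_exponent_antichain[OF finite] by (metis imageE)
  qed
  have "inj (\<lambda>m. Poly_Mapping.single m (1::'k) :: ('a set cut_var, 'k) mpoly)"
    by (rule injI) (rule single_one_inject)
  then have "card ?G = card ?M"
    by (intro card_image) (rule inj_on_subset, auto)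
  then have "card ?G = 2 ^ (n - c)"
    using card_cut_exponents[OF assms(1)] assms(2,4) by simp
  then show ?thesis unfolding minimal_iff by blast
qed

end
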